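(* Suppose that there are a constant $L_1\in\mathbb R$ and constants $L_2,L_3>0$ such that for all $x,y\in\mathbb R^d$ $$2\langle b(x)-b(y),x-y\rangle+\|\sigma(x)-\sigma(y)\|^2\le L_1|x-y|^2,\qquad 2\langle b(x),x\rangle+\|\sigma(x)\|^2\le L_2-L_3|x|^2 .$$ Let $\theta\in(1/2,1]$. For any $\tau\in(0,1)$ with $L_1\theta\tau<2$ and any constant $\lambda\in(0,2\theta-1]$, the function $V_\theta:\mathbb R^d\to[1,\infty)$ defined by $$V_\theta(x):=|x-(1-\theta+\lambda)b(x)\tau|^2+(2\theta-1-\lambda)\|\sigma(x)\|^2\tau+1,\quad x\in\mathbb R^d,$$ satisfies $\lim_{|x|\to\infty}V_\theta(x)=\infty$ and $PV_\theta\le\rho V_\theta+\kappa$ with $$\rho:=\frac{1+(1-\theta)L_3\tau}{1+(1-\theta+\lambda)L_3\tau}\in(0,1),\qquad \kappa:=L_2\tau+(1-\rho)>0,$$ where $P$ is the transition operator of the stochastic theta method $(X_n)_{n\in\mathbb N}$; i.e., for $n\in\mathbb N$, $$\mathbb E[V_\theta(X_{n+1})\mid\mathscr F_n]\le\frac{1+(1-\theta)L_3\tau}{1+(1-\theta+\lambda)L_3\tau}V_\theta(X_n)+L_2\tau+\frac{\lambda L_3\tau}{1+(1-\theta+\lambda)L_3\tau}.$$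
   Context: Throughout, $W$ is an $\mathbb R^m$-valued standard Wiener process on a complete filtered probability space $(\Omega,\mathscr F,(\mathscr F(t))_{t\ge0},\mathbb P)$, and $b:\mathbb R^d\to\mathbb R^d$, $\sigma:\mathbb R^d\to\mathbb R^{d\times m}$ are continuous. $\langle\cdot,\cdot\rangle$ and $|\cdot|$ are the Euclidean inner product and norm; $\|\cdot\|$ is the Hilbert--Schmidt (Frobenius) norm on $\mathbb R^{d\times m}$; $\mathbb N=\{0,1,2,\dots\}$. The stochastic theta method (STM) with $\theta\in[0,1]$ and step size $\tau\in(0,1)$ for $\mathrm dX=b(X)\mathrm dt+\sigma(X)\mathrm dW$ is $$X_{j+1}=X_j+(1-\theta)b(X_j)\tau+\theta b(X_{j+1})\tau+\sigma(X_j)\delta_jW,\quad j\in\mathbb N,$$ with $\delta_jW:=W(t_{j+1})-W(t_j)$, $t_j=j\tau$, $\mathscr F_j:=\mathscr F(t_j)$, and $X_0$ an $\mathscr F_0$-measurable initial state. Under the first inequality of the claim and $L_1\theta\tau<2$ this recursion is uniquely solvable and $(X_n)$ is a homogeneous $(\mathscr F_n)$-adapted Markov chain. Its transition kernel is $P(x,A)=\mathbb P(X_{n+1}\in A\mid X_n=x)$, and $P\phi(x)=\int\phi(y)P(x,\mathrm dy)$. *)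

theory Defs
  imports "HOL-Probability.Probability"
begin

text \<open>
  Time is real-valued, but only the indices \<open>t \<ge> 0\<close> of filtrations and processes are constrained.
  Completeness means that the probability space is complete and that \<open>F 0\<close> contains all null sets;
  right-continuity of the filtration is not required.
\<close>

locale complete_filtered_prob_space = prob_space M + complete_measure M
  for M :: "'w measure" +
  fixes F :: "real \<Rightarrow> 'w measure"
  assumes subalgebra_F: "0 \<le> t \<Longrightarrow> subalgebra M (F t)"
    and sets_F_mono: "0 \<le> s \<Longrightarrow> s \<le> t \<Longrightarrow> sets (F s) \<subseteq> sets (F t)"
    and null_sets_F: "null_sets M \<subseteq> sets (F 0)"

text \<open>
  The three assumptions on increments say that \<open>W t - W s\<close> is independent of \<open>F s\<close> and distributed
  as \<open>N(0, (t - s) I)\<close>.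
\<close>

locale wiener_process = complete_filtered_prob_space M F
  for M :: "'w measure" and F :: "real \<Rightarrow> 'w measure" +
  fixes W :: "real \<Rightarrow> 'w \<Rightarrow> real ^ 'm"
  assumes adapted: "0 \<le> t \<Longrightarrow> W t \<in> borel_measurable (F t)"
    and start_0: "AE \<omega> in M. W 0 \<omega> = 0"
    and continuous_paths: "AE \<omega> in M. continuous_on {0..} (\<lambda>t. W t \<omega>)"
    and increment_indep_past: "0 \<le> s \<Longrightarrow> s < t \<Longrightarrow>
      indep_set (sets (F s)) (sets (vimage_algebra (space M) (\<lambda>\<omega>. W t \<omega> - W s \<omega>) borel))"
    and increment_indep_components: "0 \<le> s \<Longrightarrow> s < t \<Longrightarrow>
      indep_vars (\<lambda>_. borel) (\<lambda>i \<omega>. (W t \<omega> - W s \<omega>) $ i) UNIV"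
    and increment_normal: "0 \<le> s \<Longrightarrow> s < t \<Longrightarrow>
      distributed M lborel (\<lambda>\<omega>. (W t \<omega> - W s \<omega>) $ i) (normal_density 0 (sqrt (t - s)))"

text \<open>
  The stochastic theta method as an implicit recursion. The recursion is required almost surely,
  and adaptedness of \<open>X\<close> is not assumed.
\<close>

definition stm_solution ::
  "'w measure \<Rightarrow> (real \<Rightarrow> 'w measure) \<Rightarrow> (real \<Rightarrow> 'w \<Rightarrow> real ^ 'm)
    \<Rightarrow> (real ^ 'd \<Rightarrow> real ^ 'd) \<Rightarrow> (real ^ 'd \<Rightarrow> real ^ 'm ^ 'd) \<Rightarrow> real \<Rightarrow> real
    \<Rightarrow> (nat \<Rightarrow> 'w \<Rightarrow> real ^ 'd) \<Rightarrow> bool" where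
  "stm_solution M F W b \<sigma> \<theta> \<tau> X \<longleftrightarrow>
     X 0 \<in> borel_measurable (F 0) \<and>
     (\<forall>j. AE \<omega> in M.
        X (Suc j) \<omega> = X j \<omega> + ((1 - \<theta>) * \<tau>) *\<^sub>R b (X j \<omega>) + (\<theta> * \<tau>) *\<^sub>R b (X (Suc j) \<omega>)
          + \<sigma> (X j \<omega>) *v (W (real (Suc j) * \<tau>) \<omega> - W (real j * \<tau>) \<omega>))"

text \<open>
  \<open>K\<close> is a Markov kernel on \<open>\<real>\<^sup>d\<close> (\<open>prob_algebra borel\<close> is the space of Borel probability measures),
  and every solution of the scheme, whatever its initial state, is a homogeneous Markov chain with
  one-step transition probabilities \<open>K\<close>. Conditional probabilities given \<open>X n = x\<close> are determined
  only up to null sets of the law of \<open>X n\<close>; ranging over all initial states, in particular the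
  deterministic ones, pins down \<open>K x\<close> for each \<open>x\<close>.
\<close>

definition stm_transition_kernel ::
  "'w measure \<Rightarrow> (real \<Rightarrow> 'w measure) \<Rightarrow> (real \<Rightarrow> 'w \<Rightarrow> real ^ 'm)
    \<Rightarrow> (real ^ 'd \<Rightarrow> real ^ 'd) \<Rightarrow> (real ^ 'd \<Rightarrow> real ^ 'm ^ 'd) \<Rightarrow> real \<Rightarrow> real
    \<Rightarrow> (real ^ 'd \<Rightarrow> (real ^ 'd) measure) \<Rightarrow> bool" where
  "stm_transition_kernel M F W b \<sigma> \<theta> \<tau> K \<longleftrightarrow>
     K \<in> borel \<rightarrow>\<^sub>M prob_algebra borel \<and>
     (\<forall>X. stm_solution M F W b \<sigma> \<theta> \<tau> X \<longrightarrow>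
        (\<forall>n. \<forall>A\<in>sets borel. AE \<omega> in M.
           real_cond_exp M (F (real n * \<tau>)) (indicat_real {\<omega> \<in> space M. X (Suc n) \<omega> \<in> A}) \<omega>
             = measure (K (X n \<omega>)) A))"

definition transition_op ::
  "('a \<Rightarrow> 'a measure) \<Rightarrow> ('a \<Rightarrow> real) \<Rightarrow> 'a \<Rightarrow> real" where
  "transition_op K \<phi> x = (\<integral>y. \<phi> y \<partial>K x)"

text \<open>
  On the type \<open>real ^ 'm ^ 'd\<close> of \<open>d \<times> m\<close> matrices, \<open>norm\<close> is the Hilbert--Schmidt norm: it is the
  Euclidean norm of the vector of Euclidean norms of the rows.
\<close>

definition stm_lyapunov ::
  "(real ^ 'd \<Rightarrow> real ^ 'd) \<Rightarrow> (real ^ 'd \<Rightarrow> real ^ 'm ^ 'd) \<Rightarrow> real \<Rightarrow> real \<Rightarrow> real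
    \<Rightarrow> real ^ 'd \<Rightarrow> real" where
  "stm_lyapunov b \<sigma> \<theta> \<tau> l x =
     (norm (x - ((1 - \<theta> + l) * \<tau>) *\<^sub>R b x))\<^sup>2 + (2 * \<theta> - 1 - l) * (norm (\<sigma> x))\<^sup>2 * \<tau> + 1"

end

theory Submission
  imports Defs
begin

text \<open>
  One step of the method is \<open>G(X\<^sub>n\<^sub>+\<^sub>1) = X\<^sub>n + (1 - \<theta>) \<tau> b(X\<^sub>n) + \<sigma>(X\<^sub>n) \<delta>\<^sub>nW\<close> with
  \<open>G(z) = z - \<theta> \<tau> b(z)\<close>. The one-sided Lipschitz condition makes \<open>G\<close> expansive, so by invariance of
  domain it is a homeomorphism, and independence of \<open>\<delta>\<^sub>nW\<close> from \<open>F\<^sub>n\<close> yields the transition kernel.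
  Put \<open>c = 1 - \<theta>\<close>, \<open>a = c + \<lambda>\<close>, \<open>h = L\<^sub>3 \<tau>\<close>. Two inequalities give the drift estimate. First,
  \<open>V(z) \<le> (1 + a h) / (1 + \<theta> h) * |G(z)|^2 + (\<theta> - a) L\<^sub>2 \<tau> + 1\<close>: discarding the factor on the right
  would lose too much when \<open>\<lambda> < 2 \<theta> - 1\<close>. Second, the mean
  \<open>|x + c \<tau> b(x)|^2 + \<tau> \<parallel>\<sigma>(x)\<parallel>^2\<close> of \<open>|G(X\<^sub>n\<^sub>+\<^sub>1)|^2\<close> is bounded by \<open>V(x)\<close> using dissipativity twice:
  directly, and through its consequence \<open>\<parallel>\<sigma>\<parallel>^2 \<le> L\<^sub>2 + |b|^2 / L\<^sub>3\<close>.
\<close>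

subsection \<open>Two polynomial inequalities\<close>

text \<open>
  Here \<open>X = |x|^2\<close>, \<open>p = \<tau> \<langle>b(x), x\<rangle>\<close>, \<open>B = \<tau>^2 |b(x)|^2\<close>, \<open>S = \<tau> \<parallel>\<sigma>(x)\<parallel>^2\<close>, \<open>K = L\<^sub>2 \<tau>\<close> and
  \<open>h = L\<^sub>3 \<tau>\<close>; the assumption \<open>square\<close> is \<open>0 \<le> |h x + \<tau> b(x)|^2\<close>.
\<close>

lemma theta_drift_inequality:
  fixes X p B S K h a c \<theta> :: real
  assumes X: "0 \<le> X" and B: "0 \<le> B" and S: "0 \<le> S" and K: "0 \<le> K" and h: "0 < h"
    and c: "0 \<le> c" "c \<le> a" and a: "a \<le> \<theta>" and \<theta>: "\<theta> = 1 - c"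
    and dissip: "2 * p + S \<le> K - h * X"
    and square: "0 \<le> h\<^sup>2 * X + 2 * h * p + B"
  shows "(1 + a * h)\<^sup>2 * (X + 2 * c * p + c\<^sup>2 * B + S)
    \<le> (1 + \<theta> * h) * ((1 + c * h) * (X - 2 * a * p + a\<^sup>2 * B + (\<theta> - a) * S)
        + (1 + a * h) * (a + c) * K)"
proof -
  \<comment> \<open>\<open>N / D\<close> will be \<open>\<rho>\<close> and \<open>D / T\<close> will
    be the factor \<open>contraction\<close>, so the claim is the drift bound for \<open>V\<close>
    multiplied by \<open>D * T\<close>.\<close>
  define T N D e where "T = 1 + \<theta> * h" and "N = 1 + c * h" and "D = 1 + a * h"
    and "e = (2 * a - 1) + h * (a\<^sup>2 - \<theta> * c)"
  define P where "P = T * N * a\<^sup>2 - D\<^sup>2 * c\<^sup>2"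
  define Q where "Q = T * a * (a - c) + D * c * (\<theta> - a)"
  have nn: "0 \<le> a" "0 \<le> \<theta>" "0 \<le> T" "0 \<le> N" "0 \<le> D" "c \<le> \<theta>" "a \<le> 1" "c \<le> 1/2"
    using c a \<theta> h by (auto simp: T_def N_def D_def)
  \<comment> \<open>Every coefficient in powers of \<open>h\<close> is nonnegative for c \<le> a
    \<le> \<theta> = 1 - c; the middle one uses 2c \<le> 1.\<close>
  have P_eq: "P = (a\<^sup>2 - c\<^sup>2) + h * (a\<^sup>2 - 2 * a * c\<^sup>2) + h\<^sup>2 * (c * a\<^sup>2 * (\<theta> - c))"
    unfolding P_def T_def N_def D_def \<theta> by algebra
  have ac: "c\<^sup>2 \<le> a\<^sup>2" "2 * a * c\<^sup>2 \<le> a\<^sup>2"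
  proof -
    show "c\<^sup>2 \<le> a\<^sup>2" using c by (intro power_mono)
    have "c * (2 * c) \<le> a * 1" using c nn by (intro mult_mono) auto
    from mult_left_mono[OF this nn(1)] show "2 * a * c\<^sup>2 \<le> a\<^sup>2"
      by (simp add: power2_eq_square mult_ac)
  qed
  have P0: "0 \<le> P"
    unfolding P_eq using ac h c nn by (intro add_nonneg_nonneg mult_nonneg_nonneg) auto
  have Q0: "0 \<le> Q"
    unfolding Q_def using c a nn by (intro add_nonneg_nonneg mult_nonneg_nonneg) auto
  \<comment> \<open>\<open>eP\<close> and \<open>eQ\<close> say that the surplus \<open>P\<close> on
    \<open>B\<close> and the surplus \<open>Q\<close> on \<open>h * K\<close> are large enough to
    pay for \<open>S\<close> through the bound h S \<le> h K + B.\<close>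
  have eP: "\<theta> * e \<le> P"
  proof -
    have "P - \<theta> * e = ((\<theta> - a)\<^sup>2 + c * (2 * \<theta> - 1))
        + h * (c * ((\<theta> - a)\<^sup>2 + 2 * a * (\<theta> - c))) + h\<^sup>2 * (c * a\<^sup>2 * (\<theta> - c))"
      unfolding P_eq e_def \<theta> by algebra
    moreover have "\<dots> \<ge> 0" using h c nn \<theta> by (intro add_nonneg_nonneg mult_nonneg_nonneg) auto
    ultimately show ?thesis by linarith
  qed
  have eQ: "\<theta> * e \<le> Q"
  proof -
    have "Q - \<theta> * e = (\<theta> - a) * (2 - \<theta> - a) + h * (c * ((\<theta> - a) * (\<theta> + a)))"
      unfolding Q_def T_def D_def e_def \<theta> by algebra
    moreover have "\<dots> \<ge> 0" using h c nn a \<theta> by (intro add_nonneg_nonneg mult_nonneg_nonneg) auto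
    ultimately show ?thesis by linarith
  qed
  \<comment> \<open>\<open>- \<theta> e h\<close> is the coefficient left on \<open>S\<close> after eliminating \<open>p\<close>; if \<open>e > 0\<close>, \<open>dissip\<close> and \<open>square\<close> bound \<open>h S\<close> by \<open>h K + B\<close>.\<close>
  have eS: "\<theta> * e * (h * S) \<le> Q * (h * K) + P * B"
  proof (cases "0 \<le> e")
    case True
    have "h * (2 * p + S) \<le> h * (K - h * X)" using dissip h by (intro mult_left_mono) auto
    then have "h * S \<le> h * K + B" using square by (simp add: algebra_simps power2_eq_square)
    then have "\<theta> * e * (h * S) \<le> \<theta> * e * (h * K + B)" using True nn by (intro mult_left_mono) auto
    also have "\<dots> = \<theta> * e * (h * K) + \<theta> * e * B" by algebra
    also have "\<dots> \<le> Q * (h * K) + P * B"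
      using eP eQ h K B by (intro add_mono mult_right_mono) auto
    finally show ?thesis .
  next
    case False
    then have "\<theta> * e * (h * S) \<le> 0" using nn h S by (simp add: mult_nonneg_nonpos mult_nonpos_nonneg)
    also have "0 \<le> Q * (h * K) + P * B" using P0 Q0 h K B by simp
    finally show ?thesis .
  qed
  \<comment> \<open>The weight \<open>T * N * a + D\<^sup>2 * c\<close> on the slack of
    \<open>dissip\<close> is the one that eliminates \<open>p\<close>. What then remains on
    \<open>X\<close> is nonnegative because a \<le> 1.\<close>
  have "T * (N * (X - 2 * a * p + a\<^sup>2 * B + (\<theta> - a) * S) + D * (a + c) * K)
      - D\<^sup>2 * (X + 2 * c * p + c\<^sup>2 * B + S)
    = (T * N * a + D\<^sup>2 * c) * (K - h * X - (2 * p + S))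
      + D * h * ((1 - a + c) + c * h * (\<theta> + a)) * X
      + (Q * (h * K) + P * B - \<theta> * e * (h * S))"
    unfolding P_def Q_def e_def T_def N_def D_def \<theta> by algebra
  moreover have "\<dots> \<ge> 0"
    using dissip eS nn c h X by (intro add_nonneg_nonneg mult_nonneg_nonneg) auto
  ultimately show ?thesis unfolding T_def N_def D_def by linarith
qed

text \<open>The difference of the two sides is a nonnegative combination of the slack of
  \<open>dissip\<close>, the expression in \<open>square\<close>, and \<open>B\<close>. All three
  weights carry the factor \<theta> - a, so equality holds at a = \<theta>.\<close>

lemma theta_resolvent_inequality:
  fixes X p B S K h a \<theta> :: real
  assumes B: "0 \<le> B" and h: "0 < h" and a: "0 \<le> a" "a \<le> \<theta>"
    and dissip: "2 * p + S \<le> K - h * X"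
    and square: "0 \<le> h\<^sup>2 * X + 2 * h * p + B"
  shows "(1 + \<theta> * h) * (X - 2 * a * p + a\<^sup>2 * B + (\<theta> - a) * S)
    \<le> (1 + a * h) * (X - 2 * \<theta> * p + \<theta>\<^sup>2 * B) + (1 + \<theta> * h) * ((\<theta> - a) * K)"
proof -
  have "(1 + a * h) * (X - 2 * \<theta> * p + \<theta>\<^sup>2 * B) + (1 + \<theta> * h) * ((\<theta> - a) * K)
      - (1 + \<theta> * h) * (X - 2 * a * p + a\<^sup>2 * B + (\<theta> - a) * S)
    = (1 + \<theta> * h) * (\<theta> - a) * (K - h * X - (2 * p + S))
      + (\<theta> - a) * (\<theta> * (h\<^sup>2 * X + 2 * h * p + B) + (a + a * \<theta> * h) * B)"
    by algebra
  moreover have "\<dots> \<ge> 0"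
    using B h a dissip square
    by (intro add_nonneg_nonneg[of "_ * _"] mult_nonneg_nonneg add_nonneg_nonneg[of "\<theta> * _"]
        add_nonneg_nonneg[of 1] add_nonneg_nonneg[of a]) auto
  ultimately show ?thesis by linarith
qed

subsection \<open>Expansive maps, conditioning and Gaussian increments\<close>

text \<open>The range is open by invariance of domain. It is closed because expansion turns
  convergent images into Cauchy preimages. By connectedness it is the whole space, and the expansion
  bound read backwards makes the inverse Lipschitz with constant 1/k.\<close>

lemma expansive_continuous_bij:
  fixes G :: "'a::euclidean_space \<Rightarrow> 'a"
  assumes cont: "continuous_on UNIV G" and k: "0 < k"
    and expand: "\<And>x y. k * norm (x - y) \<le> norm (G x - G y)"
  shows "bij G" and "continuous_on UNIV (inv G)"
proof -
  have inj: "inj G"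
  proof (rule injI)
    fix x y assume "G x = G y"
    with expand[of x y] k show "x = y" by (simp add: mult_le_0_iff)
  qed
  have "open (range G)"
    using cont inj by (intro invariance_of_domain) auto
  moreover have "closed (range G)"
    unfolding closed_sequential_limits
  proof (intro allI impI, elim conjE)
    fix y l assume y: "\<forall>n. y n \<in> range G" and lim: "y \<longlonglongrightarrow> l"
    from y have "\<forall>n. \<exists>x. y n = G x" by auto
    then obtain x where x: "\<And>n. y n = G (x n)" by metis
    have "Cauchy x"
    proof (rule metric_CauchyI)
      fix e :: real assume "0 < e"
      with k have "0 < k * e" by simp
      from metric_CauchyD[OF LIMSEQ_imp_Cauchy[OF lim] this]
      obtain n0 where n0: "\<forall>m\<ge>n0. \<forall>n\<ge>n0. dist (y m) (y n) < k * e" by blast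
      show "\<exists>n0. \<forall>m\<ge>n0. \<forall>n\<ge>n0. dist (x m) (x n) < e"
      proof (intro exI allI impI)
        fix m n assume "n0 \<le> m" "n0 \<le> n"
        with n0 have "dist (y m) (y n) < k * e" by blast
        then have "k * norm (x m - x n) < k * e"
          using expand[of "x m" "x n"] by (simp add: dist_norm x)
        with k show "dist (x m) (x n) < e" by (simp add: dist_norm)
      qed
    qed
    then obtain x0 where "x \<longlonglongrightarrow> x0" by (metis Cauchy_convergent convergent_def)
    then have "(\<lambda>n. G (x n)) \<longlonglongrightarrow> G x0"
      using cont by (auto simp: continuous_on_eq_continuous_at intro: isCont_tendsto_compose)
    with lim have "l = G x0" by (simp add: x[symmetric] LIMSEQ_unique)
    then show "l \<in> range G" by simp
  qed
  ultimately have "range G = UNIV" using clopen[of "range G"] by auto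
  with inj show bij: "bij G" by (simp add: bij_def)
  have Ginv: "G (inv G y) = y" for y using bij by (simp add: bij_is_surj surj_f_inv_f)
  have "(1 / k)-lipschitz_on UNIV (inv G)"
  proof (rule lipschitz_onI)
    fix x y show "dist (inv G x) (inv G y) \<le> 1 / k * dist x y"
      using expand[of "inv G x" "inv G y"] k by (simp add: Ginv dist_norm field_simps)
  qed (use k in simp)
  then show "continuous_on UNIV (inv G)" by (rule lipschitz_on_continuous_on)
qed

text \<open>Freezing: given \<open>F\<close>, the variable \<open>X\<close> may be treated as a
  constant and only \<open>Y\<close> is averaged. Fubini on the product law gives the identity that
  characterises the conditional expectation; since \<open>f\<close> is nonnegative, no integrability
  is involved.\<close>

lemma (in prob_space) nn_cond_exp_indep:
  assumes F: "subalgebra M F"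
    and X: "X \<in> F \<rightarrow>\<^sub>M S" and Y: "Y \<in> M \<rightarrow>\<^sub>M T"
    and indep: "indep_set (sets F) (sets (vimage_algebra (space M) Y T))"
    and f: "f \<in> borel_measurable (S \<Otimes>\<^sub>M T)"
  shows "AE \<omega> in M. nn_cond_exp M F (\<lambda>\<omega>. f (X \<omega>, Y \<omega>)) \<omega> = (\<integral>\<^sup>+y. f (X \<omega>, y) \<partial>distr M T Y)"
proof -
  have spF: "space F = space M" using F by (simp add: subalgebra_def)
  interpret Y: prob_space "distr M T Y" using Y by (rule prob_space_distr)
  interpret finite_measure_subalgebra M F
    by unfold_locales (rule F)
  \<comment> \<open>The identity as a random element of \<open>F\<close> carries the whole
    sigma-algebra at once: independence becomes a product law for the pair, and both
    \<open>X\<close> and the indicator of any \<open>A\<close> in \<open>F\<close> are functions of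
    its first coordinate.\<close>
  have idF: "(\<lambda>\<omega>. \<omega>) \<in> M \<rightarrow>\<^sub>M F"
    using measurable_from_subalg[OF F, of "\<lambda>\<omega>. \<omega>" F] by simp
  interpret F: prob_space "distr M F (\<lambda>\<omega>. \<omega>)" using idF by (rule prob_space_distr)
  have joint: "distr M F (\<lambda>\<omega>. \<omega>) \<Otimes>\<^sub>M distr M T Y = distr M (F \<Otimes>\<^sub>M T) (\<lambda>\<omega>. (\<omega>, Y \<omega>))"
  proof (rule pair_measure_eqI)
    fix A B assume "A \<in> sets (distr M F (\<lambda>\<omega>. \<omega>))" "B \<in> sets (distr M T Y)"
    then have A: "A \<in> sets F" and B: "B \<in> sets T" by auto
    have sp: "(\<lambda>\<omega>. (\<omega>, Y \<omega>)) -` (A \<times> B) \<inter> space M = A \<inter> (Y -` B \<inter> space M)"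
      "A \<inter> space M = A"
      using sets.sets_into_space[OF A] by (auto simp: spF)
    have "prob (A \<inter> (Y -` B \<inter> space M)) = prob A * prob (Y -` B \<inter> space M)"
      using indep A in_vimage_algebra[OF B, of Y "space M"] by (simp add: indep_sets2_eq)
    then show "emeasure (distr M F (\<lambda>\<omega>. \<omega>)) A * emeasure (distr M T Y) B
        = emeasure (distr M (F \<Otimes>\<^sub>M T) (\<lambda>\<omega>. (\<omega>, Y \<omega>))) (A \<times> B)"
      using A B idF Y
      by (simp add: emeasure_distr sp measurable_Pair emeasure_eq_measure ennreal_mult'[symmetric])
  qed (auto simp: F.sigma_finite_measure_axioms Y.sigma_finite_measure_axioms)
  note [measurable] = X f Y idF measurable_from_subalg[OF F X]
  show ?thesis
  proof (rule AE_mp[OF nn_cond_exp_charact])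
    fix A assume [measurable]: "A \<in> sets F"
    have "(\<integral>\<^sup>+\<omega>\<in>A. f (X \<omega>, Y \<omega>) \<partial>M)
        = (\<integral>\<^sup>+z. f (X (fst z), snd z) * indicator A (fst z) \<partial>distr M (F \<Otimes>\<^sub>M T) (\<lambda>\<omega>. (\<omega>, Y \<omega>)))"
      by (subst nn_integral_distr) auto
    also have "\<dots> = (\<integral>\<^sup>+\<omega>. \<integral>\<^sup>+y. f (X \<omega>, y) * indicator A \<omega> \<partial>distr M T Y \<partial>distr M F (\<lambda>\<omega>. \<omega>))"
      unfolding joint[symmetric] by (subst Y.nn_integral_fst[symmetric]) auto
    also have "\<dots> = (\<integral>\<^sup>+\<omega>\<in>A. (\<integral>\<^sup>+y. f (X \<omega>, y) \<partial>distr M T Y) \<partial>M)"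
      by (subst nn_integral_distr) (auto intro!: nn_integral_cong simp: nn_integral_multc)
    finally show "(\<integral>\<^sup>+\<omega>\<in>A. f (X \<omega>, Y \<omega>) \<partial>M) = (\<integral>\<^sup>+\<omega>\<in>A. (\<integral>\<^sup>+y. f (X \<omega>, y) \<partial>distr M T Y) \<partial>M)" .
  qed auto
qed

text \<open>Normality of Wiener increments is given componentwise only; this recovers the law of the
  vector from the component laws.\<close>

lemma (in prob_space) distr_vec_indep:
  fixes X :: "'a \<Rightarrow> real ^ 'm"
  assumes indep: "indep_vars (\<lambda>_. borel) (\<lambda>i \<omega>. X \<omega> $ i) UNIV"
  shows "distr M borel X = distr (\<Pi>\<^sub>M i\<in>UNIV. distr M borel (\<lambda>\<omega>. X \<omega> $ i)) borel (\<lambda>f. \<chi> i. f i)"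
proof -
  have [measurable]: "(\<lambda>\<omega>. X \<omega> $ i) \<in> borel_measurable M" for i
    using indep by (auto simp: indep_vars_def)
  have vec[measurable]: "(\<lambda>f::'m \<Rightarrow> real. \<chi> i. f i) \<in> borel_measurable (\<Pi>\<^sub>M i\<in>UNIV. borel)"
    by (subst borel_measurable_euclidean_space) (auto simp: Basis_vec_def inner_axis)
  have "distr M (\<Pi>\<^sub>M i\<in>UNIV. borel) (\<lambda>\<omega> i. X \<omega> $ i) = (\<Pi>\<^sub>M i\<in>UNIV. distr M borel (\<lambda>\<omega>. X \<omega> $ i))"
    using indep indep_vars_iff_distr_eq_PiM[where I=UNIV and M'="\<lambda>_. borel" and X="\<lambda>i \<omega>. X \<omega> $ i"] by (simp add: restrict_def)
  from this[symmetric] show ?thesis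
    by (simp add: distr_distr comp_def measurable_PiM_single')
qed

text \<open>Expand row by row: the terms linear in \<open>Z\<close> vanish by centring, the
  off-diagonal products by independence, and the diagonal leaves \<open>v\<close> times the sum of
  the squared entries of \<open>A\<close>.\<close>

lemma (in prob_space) has_bochner_integral_norm_affine_square:
  fixes Z :: "'a \<Rightarrow> real ^ 'm" and y :: "real ^ 'd" and A :: "real ^ 'm ^ 'd"
  assumes indep: "indep_vars (\<lambda>_. borel) (\<lambda>i \<omega>. Z \<omega> $ i) UNIV"
    and mean: "\<And>i. has_bochner_integral M (\<lambda>\<omega>. Z \<omega> $ i) 0"
    and second: "\<And>i. has_bochner_integral M (\<lambda>\<omega>. (Z \<omega> $ i)\<^sup>2) v"
  shows "has_bochner_integral M (\<lambda>\<omega>. (norm (y + A *v Z \<omega>))\<^sup>2) ((norm y)\<^sup>2 + v * (norm A)\<^sup>2)"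
proof -
  have cov: "has_bochner_integral M (\<lambda>\<omega>. Z \<omega> $ i * Z \<omega> $ j) (if i = j then v else 0)" for i j
  proof (cases "i = j")
    case True
    then show ?thesis using second[of i] by (simp add: power2_eq_square)
  next
    case False
    have I: "indep_vars (\<lambda>_. borel) (\<lambda>i \<omega>. Z \<omega> $ i) {i, j}"
      using indep by (rule indep_vars_subset) simp
    have Z: "\<And>i. integrable M (\<lambda>\<omega>. Z \<omega> $ i)" "\<And>i. (\<integral>\<omega>. Z \<omega> $ i \<partial>M) = 0"
      using mean by (auto simp: has_bochner_integral_iff)
    show ?thesis
      using indep_vars_integrable[OF _ I Z(1)] indep_vars_lebesgue_integral[OF _ I Z(1)] False Z(2)
      by (simp add: has_bochner_integral_iff)
  qed
  have norm_eq: "(norm (y + A *v z))\<^sup>2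
      = (\<Sum>k\<in>UNIV. (y $ k)\<^sup>2 + 2 * (y $ k) * (\<Sum>i\<in>UNIV. A $ k $ i * z $ i)
          + (\<Sum>i\<in>UNIV. \<Sum>j\<in>UNIV. (A $ k $ i * A $ k $ j) * (z $ i * z $ j)))" for z
    unfolding power2_norm_eq_inner inner_vec_def
  proof (rule sum.cong[OF refl])
    fix k
    let ?s = "\<Sum>i\<in>UNIV. A $ k $ i * z $ i"
    have "?s * ?s = (\<Sum>i\<in>UNIV. \<Sum>j\<in>UNIV. (A $ k $ i * A $ k $ j) * (z $ i * z $ j))"
      by (simp add: sum_product mult_ac)
    then show "(y + A *v z) $ k \<bullet> (y + A *v z) $ k = (y $ k)\<^sup>2 + 2 * (y $ k) * ?s
        + (\<Sum>i\<in>UNIV. \<Sum>j\<in>UNIV. (A $ k $ i * A $ k $ j) * (z $ i * z $ j))"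
      by (simp add: matrix_vector_mult_def power2_eq_square algebra_simps)
  qed
  have "has_bochner_integral M (\<lambda>\<omega>. (norm (y + A *v Z \<omega>))\<^sup>2)
      (\<Sum>k\<in>UNIV. (y $ k)\<^sup>2 + 2 * (y $ k) * (\<Sum>i\<in>UNIV. A $ k $ i * 0)
          + (\<Sum>i\<in>UNIV. \<Sum>j\<in>UNIV. (A $ k $ i * A $ k $ j) * (if i = j then v else 0)))"
    unfolding norm_eq
  proof (intro has_bochner_integral_sum has_bochner_integral_add has_bochner_integral_mult_right mean cov)
    fix k show "has_bochner_integral M (\<lambda>\<omega>. (y $ k)\<^sup>2) ((y $ k)\<^sup>2)"
      by (simp add: has_bochner_integral_iff prob_space)
  qed
  moreover have "(\<Sum>k\<in>UNIV. (y $ k)\<^sup>2 + 2 * (y $ k) * (\<Sum>i\<in>UNIV. A $ k $ i * 0)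
          + (\<Sum>i\<in>UNIV. \<Sum>j\<in>UNIV. (A $ k $ i * A $ k $ j) * (if i = j then v else 0)))
      = (norm y)\<^sup>2 + v * (norm A)\<^sup>2"
  proof -
    have "(\<Sum>j\<in>UNIV. (A $ k $ i * A $ k $ j) * (if i = j then v else 0)) = v * (A $ k $ i)\<^sup>2" for k i
      by (simp add: if_distrib[of "(*) _"] power2_eq_square mult_ac cong: if_cong)
    moreover have "(norm A)\<^sup>2 = (\<Sum>k\<in>UNIV. \<Sum>i\<in>UNIV. (A $ k $ i)\<^sup>2)"
      "(norm y)\<^sup>2 = (\<Sum>k\<in>UNIV. (y $ k)\<^sup>2)"
      unfolding power2_norm_eq_inner inner_vec_def by (simp_all add: power2_eq_square)
    ultimately show ?thesis by (simp add: sum.distrib sum_distrib_left)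
  qed
  ultimately show ?thesis by simp
qed

text \<open>The recursion holds only almost surely, so adaptedness must survive changes on null
  sets. Preimages under \<open>f\<close> and \<open>g\<close> differ inside a null set, all of whose
  subsets lie in \<open>F 0\<close> by completeness.\<close>

lemma (in complete_filtered_prob_space) measurable_F_cong_AE:
  assumes t: "0 \<le> t" and f: "f \<in> F t \<rightarrow>\<^sub>M N" and ae: "AE \<omega> in M. f \<omega> = g \<omega>"
    and g: "\<And>\<omega>. \<omega> \<in> space M \<Longrightarrow> g \<omega> \<in> space N"
  shows "g \<in> F t \<rightarrow>\<^sub>M N"
proof (rule measurableI)
  have sp: "space (F t) = space M" using subalgebra_F[OF t] by (simp add: subalgebra_def)
  fix x assume "x \<in> space (F t)" then show "g x \<in> space N" using g sp by simp
next
  have sp: "space (F t) = space M" using subalgebra_F[OF t] by (simp add: subalgebra_def)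
  fix A assume A: "A \<in> sets N"
  from ae obtain D where D: "{\<omega> \<in> space M. f \<omega> \<noteq> g \<omega>} \<subseteq> D" "D \<in> null_sets M"
    by (auto simp: eventually_ae_filter)
  have null: "C \<in> sets (F t)" if "C \<subseteq> D" for C
    using complete2[OF that D(2)] null_sets_F sets_F_mono[of 0 t] t by auto
  have "g -` A \<inter> space (F t) = (f -` A \<inter> space (F t) - D) \<union> (g -` A \<inter> space (F t) \<inter> D)"
    using D(1) by (auto simp: sp)
  also have "\<dots> \<in> sets (F t)"
    using measurable_sets[OF f A] null[of D] null[of "g -` A \<inter> space (F t) \<inter> D"]
    by (intro sets.Un sets.Diff) auto
  finally show "g -` A \<inter> space (F t) \<in> sets (F t)" .
qed

section \<open>Moments and stationarity of Wiener increments\<close>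

context wiener_process
begin

lemma W_measurable: "0 \<le> t \<Longrightarrow> W t \<in> borel_measurable M"
  using adapted subalgebra_F measurable_from_subalg by blast

lemma increment_component_moments:
  assumes s: "0 \<le> s" "s < t"
  shows "has_bochner_integral M (\<lambda>\<omega>. (W t \<omega> - W s \<omega>) $ i) 0"
    and "has_bochner_integral M (\<lambda>\<omega>. ((W t \<omega> - W s \<omega>) $ i)\<^sup>2) (t - s)"
proof -
  let ?s = "sqrt (t - s)" and ?Z = "\<lambda>\<omega>. (W t \<omega> - W s \<omega>) $ i"
  have pos: "0 < ?s" using s by simp
  note D = increment_normal[OF s, of i]
  have Z: "?Z \<in> borel_measurable M" using distributed_measurable[OF D] by simp
  have dens: "distr M lborel ?Z = density lborel (normal_density 0 ?s)"
    using D by (rule distributed_distr_eq_density)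
  have eq: "has_bochner_integral M (\<lambda>\<omega>. g (?Z \<omega>)) c"
    if g: "g \<in> borel_measurable borel" and I: "has_bochner_integral lborel (\<lambda>x. normal_density 0 ?s x * g x) c"
    for g :: "real \<Rightarrow> real" and c
  proof -
    have "has_bochner_integral (density lborel (normal_density 0 ?s)) g c"
      using g I by (intro has_bochner_integral_density) auto
    then have "has_bochner_integral (distr M lborel ?Z) g c" unfolding dens .
    then show ?thesis using g Z
      by (simp add: has_bochner_integral_iff integrable_distr_eq integral_distr)
  qed
  show "has_bochner_integral M ?Z 0"
    using eq[of "\<lambda>x. x" 0] normal_moment_nz_1[OF pos, of 0] by simp
  show "has_bochner_integral M (\<lambda>\<omega>. (?Z \<omega>)\<^sup>2) (t - s)"
    using eq[of "\<lambda>x. x\<^sup>2" "t - s"] normal_moment_even[OF pos, of 0 1] s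
    by (simp add: diff_divide_distrib)
qed

text \<open>The source of homogeneity of the chain: a single noise law serves every time
  step.\<close>

lemma distr_increment_cong:
  assumes s: "0 \<le> s" "s < t" and s': "0 \<le> s'" "s' < t'" and eq: "t - s = t' - s'"
  shows "distr M borel (\<lambda>\<omega>. W t \<omega> - W s \<omega>) = distr M borel (\<lambda>\<omega>. W t' \<omega> - W s' \<omega>)"
proof -
  have comp: "distr M borel (\<lambda>\<omega>. (W t \<omega> - W s \<omega>) $ i)
      = density lborel (normal_density 0 (sqrt (t - s)))" if "0 \<le> s" "s < t" for s t i
    unfolding distributed_distr_eq_density[OF increment_normal[OF that, of i], symmetric]
    by (rule distr_cong) auto
  show ?thesis
    unfolding distr_vec_indep[OF increment_indep_components[OF s]]
      distr_vec_indep[OF increment_indep_components[OF s']]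
    by (simp only: comp[OF s] comp[OF s'] eq)
qed

end

subsection \<open>The transition kernel\<close>

locale theta_method =
  fixes b :: "real ^ 'd \<Rightarrow> real ^ 'd" and \<sigma> :: "real ^ 'd \<Rightarrow> real ^ 'm ^ 'd"
    and L1 \<theta> \<tau> :: real
  assumes b_cont: "continuous_on UNIV b" and \<sigma>_cont: "continuous_on UNIV \<sigma>"
    and one_sided: "2 * ((b x - b y) \<bullet> (x - y)) + (norm (\<sigma> x - \<sigma> y))\<^sup>2 \<le> L1 * (norm (x - y))\<^sup>2"
    and \<theta>_nonneg: "0 \<le> \<theta>" and \<tau>_pos: "0 < \<tau>" and solvable: "L1 * \<theta> * \<tau> < 2"
begin

definition "implicit z = z - (\<theta> * \<tau>) *\<^sub>R b z"

definition "explicit x = x + ((1 - \<theta>) * \<tau>) *\<^sub>R b x"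

definition "step x w = inv implicit (explicit x + \<sigma> x *v w)"

text \<open>Pair the difference of the images with \<open>x - y\<close>, apply the one-sided
  Lipschitz bound, and divide the Cauchy-Schwarz estimate by the norm of \<open>x - y\<close>. The
  assumption \<open>solvable\<close> later makes the constant positive.\<close>

lemma implicit_expansive: "(1 - \<theta> * \<tau> * L1 / 2) * norm (x - y) \<le> norm (implicit x - implicit y)"
proof (cases "x = y")
  case False
  have "2 * ((b x - b y) \<bullet> (x - y)) \<le> L1 * (norm (x - y))\<^sup>2"
    using one_sided[of x y] zero_le_power2[of "norm (\<sigma> x - \<sigma> y)"] by linarith
  then have "(\<theta> * \<tau> / 2) * (2 * ((b x - b y) \<bullet> (x - y))) \<le> (\<theta> * \<tau> / 2) * (L1 * (norm (x - y))\<^sup>2)"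
    using \<theta>_nonneg \<tau>_pos by (intro mult_left_mono) auto
  moreover have "(implicit x - implicit y) \<bullet> (x - y)
      = (norm (x - y))\<^sup>2 - \<theta> * \<tau> * ((b x - b y) \<bullet> (x - y))"
  proof -
    have "implicit x - implicit y = (x - y) - (\<theta> * \<tau>) *\<^sub>R (b x - b y)"
      by (simp add: implicit_def algebra_simps)
    then show ?thesis by (simp add: inner_diff_left[of "x - y"] power2_norm_eq_inner)
  qed
  ultimately have "(1 - \<theta> * \<tau> * L1 / 2) * (norm (x - y))\<^sup>2 \<le> (implicit x - implicit y) \<bullet> (x - y)"
    by (simp add: algebra_simps)
  also have "\<dots> \<le> norm (implicit x - implicit y) * norm (x - y)" by (rule norm_cauchy_schwarz)
  finally show ?thesis using False by (simp add: power2_eq_square)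
qed simp

lemma implicit_bij: "bij implicit" and inv_implicit_cont: "continuous_on UNIV (inv implicit)"
proof -
  have cont: "continuous_on UNIV implicit"
    unfolding implicit_def by (intro continuous_intros b_cont)
  have pos: "0 < 1 - \<theta> * \<tau> * L1 / 2" using solvable by (simp add: mult_ac)
  show "bij implicit" "continuous_on UNIV (inv implicit)"
    using expansive_continuous_bij[OF cont pos implicit_expansive] by blast+
qed

lemma implicit_step: "implicit (step x w) = explicit x + \<sigma> x *v w"
  unfolding step_def using implicit_bij by (simp add: bij_is_surj surj_f_inv_f)

lemma eq_step_iff: "z = step x w \<longleftrightarrow> implicit z = explicit x + \<sigma> x *v w"
  unfolding implicit_step[symmetric] using implicit_bij by (simp add: bij_is_inj inj_eq)

text \<open>Freezing and measurability of the kernel need joint measurability in state and noise; it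
  comes from joint continuity.\<close>

lemma step_measurable: "(\<lambda>(x, w). step x w) \<in> borel \<Otimes>\<^sub>M borel \<rightarrow>\<^sub>M borel"
proof -
  have *: "continuous_on UNIV (\<lambda>p. f (fst p))" if "continuous_on UNIV f"
    for f :: "real ^ 'd \<Rightarrow> 'c::topological_space" 
    using that by (intro continuous_on_compose2[OF that] continuous_intros) auto
  have "continuous_on UNIV (\<lambda>p. explicit (fst p) + \<sigma> (fst p) *v snd p)"
    unfolding explicit_def matrix_vector_mult_def
    by (intro continuous_intros * b_cont \<sigma>_cont)
  then have "continuous_on UNIV (\<lambda>(x, w). step x w)"
    unfolding step_def case_prod_unfold
    by (intro continuous_on_compose2[OF inv_implicit_cont]) auto
  then show ?thesis
    unfolding borel_prod by (rule borel_measurable_continuous_onI)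
qed

end

section \<open>The Markov chain: noise law, adaptedness, and the unique kernel\<close>

locale theta_scheme = wiener_process M F W + theta_method b \<sigma> L1 \<theta> \<tau>
  for M :: "'w measure" and F :: "real \<Rightarrow> 'w measure" and W :: "real \<Rightarrow> 'w \<Rightarrow> real ^ 'm"
    and b :: "real ^ 'd \<Rightarrow> real ^ 'd" and \<sigma> :: "real ^ 'd \<Rightarrow> real ^ 'm ^ 'd"
    and L1 \<theta> \<tau> :: real
begin

abbreviation "\<Delta>W j \<omega> \<equiv> W (real (Suc j) * \<tau>) \<omega> - W (real j * \<tau>) \<omega>"

definition "noise = distr M borel (\<Delta>W 0)"

definition "stm_kernel x = distr noise borel (step x)"

lemma grid: "0 \<le> real j * \<tau>" "real j * \<tau> < real (Suc j) * \<tau>"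
  using \<tau>_pos by auto

lemma increment_measurable: "\<Delta>W j \<in> borel_measurable M"
  using W_measurable[of "real (Suc j) * \<tau>"] W_measurable[of "real j * \<tau>"] grid[of j] grid(1)[of "Suc j"]
  by (intro borel_measurable_diff) auto

lemma distr_increment: "distr M borel (\<Delta>W j) = noise"
  unfolding noise_def by (intro distr_increment_cong grid) (simp add: algebra_simps)

lemma prob_space_noise: "prob_space noise"
  unfolding noise_def by (intro prob_space_distr increment_measurable)

lemma sets_noise: "sets noise = sets borel"
  by (simp add: noise_def)

lemma step_measurable2: "step x \<in> borel_measurable borel"
  using measurable_compose_Pair1[OF _ step_measurable, of x] by simp

lemma kernel_measurable: "stm_kernel \<in> borel \<rightarrow>\<^sub>M prob_algebra borel"
proof -
  have "noise \<in> space (prob_algebra borel)"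
    by (simp add: space_prob_algebra prob_space_noise sets_noise)
  then have "(\<lambda>x. distr noise borel (step x)) \<in> borel \<rightarrow>\<^sub>M prob_algebra borel"
    by (intro measurable_distr_prob_space2[OF _ step_measurable] measurable_const)
  then show ?thesis unfolding stm_kernel_def[abs_def] .
qed

lemma kernel_space: "prob_space (stm_kernel x)" "sets (stm_kernel x) = sets borel"
  using measurable_space[OF kernel_measurable, of x] by (auto simp: space_prob_algebra)

lemma nn_integral_kernel:
  assumes "\<phi> \<in> borel_measurable borel"
  shows "(\<integral>\<^sup>+y. \<phi> y \<partial>stm_kernel x) = (\<integral>\<^sup>+w. \<phi> (step x w) \<partial>noise)"
  using assms step_measurable2[of x] unfolding stm_kernel_def
  by (subst nn_integral_distr) (auto simp: measurable_cong_sets[OF sets_noise])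

lemma stm_solution_iff: "stm_solution M F W b \<sigma> \<theta> \<tau> X \<longleftrightarrow> X 0 \<in> borel_measurable (F 0) \<and>
    (\<forall>j. AE \<omega> in M. X (Suc j) \<omega> = step (X j \<omega>) (\<Delta>W j \<omega>))"
proof -
  have "z = x + ((1 - \<theta>) * \<tau>) *\<^sub>R b x + (\<theta> * \<tau>) *\<^sub>R b z + \<sigma> x *v w \<longleftrightarrow> z = step x w" for x z w
    unfolding eq_step_iff implicit_def explicit_def by (auto simp: algebra_simps)
  then show ?thesis unfolding stm_solution_def by simp
qed

text \<open>Solutions are not assumed adapted. By induction the right-hand side of the recursion is
  measurable at the new time, and completeness transfers this to the solution itself.\<close>

lemma solution_adapted:
  assumes "stm_solution M F W b \<sigma> \<theta> \<tau> X"
  shows "X j \<in> borel_measurable (F (real j * \<tau>))"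
proof (induction j)
  case 0
  then show ?case using assms by (simp add: stm_solution_iff)
next
  case (Suc j)
  let ?s = "real j * \<tau>" and ?t = "real (Suc j) * \<tau>"
  have t: "0 \<le> ?t" by (rule grid)
  have le: "borel_measurable (F ?s) \<subseteq> borel_measurable (F ?t)"
    using sets_F_mono[of ?s ?t] grid[of j] subalgebra_F[of ?s] subalgebra_F[of ?t] t
    by (intro measurable_mono) (auto simp: subalgebra_def)
  have "(\<lambda>\<omega>. (X j \<omega>, \<Delta>W j \<omega>)) \<in> F ?t \<rightarrow>\<^sub>M borel \<Otimes>\<^sub>M borel"
    using subsetD[OF le Suc.IH] adapted[OF t] subsetD[OF le adapted[OF grid(1)[of j]]]
    by (intro measurable_Pair borel_measurable_diff)
  from measurable_compose[OF this step_measurable]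
  have "(\<lambda>\<omega>. step (X j \<omega>) (\<Delta>W j \<omega>)) \<in> borel_measurable (F ?t)" by simp
  then show ?case
    using assms unfolding stm_solution_iff
    by (elim measurable_F_cong_AE[OF t]) (auto simp: eq_commute)
qed

text \<open>The Markov property, by freezing \<open>X n\<close> against the increment independent of
  the past. Indicators in place of \<open>\<phi>\<close> identify the kernel, and the Lyapunov
  function gives the conditional drift.\<close>

lemma nn_cond_exp_solution:
  assumes X: "stm_solution M F W b \<sigma> \<theta> \<tau> X" and \<phi>: "\<phi> \<in> borel_measurable borel"
  shows "AE \<omega> in M. nn_cond_exp M (F (real n * \<tau>)) (\<lambda>\<omega>. \<phi> (X (Suc n) \<omega>)) \<omega>
    = (\<integral>\<^sup>+y. \<phi> y \<partial>stm_kernel (X n \<omega>))"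
proof -
  let ?F = "F (real n * \<tau>)"
  have F: "subalgebra M ?F" by (intro subalgebra_F grid)
  interpret finite_measure_subalgebra M ?F by unfold_locales (rule F)
  have f: "(\<lambda>(x, w). \<phi> (step x w)) \<in> borel_measurable (borel \<Otimes>\<^sub>M borel)"
    using measurable_compose[OF step_measurable \<phi>] by (simp add: case_prod_unfold)
  have XM: "X j \<in> borel_measurable M" for j
    using solution_adapted[OF X] measurable_from_subalg subalgebra_F grid(1) by blast
  have "AE \<omega> in M. nn_cond_exp M ?F (\<lambda>\<omega>. \<phi> (step (X n \<omega>) (\<Delta>W n \<omega>))) \<omega>
      = (\<integral>\<^sup>+w. \<phi> (step (X n \<omega>) w) \<partial>noise)"
    using nn_cond_exp_indep[OF F solution_adapted[OF X] increment_measurable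
        increment_indep_past[OF grid] f]
    by (simp only: distr_increment prod.case)
  moreover have "AE \<omega> in M. nn_cond_exp M ?F (\<lambda>\<omega>. \<phi> (X (Suc n) \<omega>)) \<omega>
      = nn_cond_exp M ?F (\<lambda>\<omega>. \<phi> (step (X n \<omega>) (\<Delta>W n \<omega>))) \<omega>"
  proof (rule nn_cond_exp_cong)
    show "AE \<omega> in M. \<phi> (X (Suc n) \<omega>) = \<phi> (step (X n \<omega>) (\<Delta>W n \<omega>))"
      using X by (auto simp: stm_solution_iff elim!: allE[of _ n] eventually_mono)
    show "(\<lambda>\<omega>. \<phi> (X (Suc n) \<omega>)) \<in> borel_measurable M"
      by (rule measurable_compose[OF XM \<phi>])
    show "(\<lambda>\<omega>. \<phi> (step (X n \<omega>) (\<Delta>W n \<omega>))) \<in> borel_measurable M"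
      using measurable_compose[OF measurable_Pair[OF XM increment_measurable] f] by simp
  qed
  ultimately show ?thesis by eventually_elim (simp add: nn_integral_kernel[OF \<phi>])
qed

lemma kernel_transition: "stm_transition_kernel M F W b \<sigma> \<theta> \<tau> stm_kernel"
  unfolding stm_transition_kernel_def
proof (intro conjI allI impI ballI kernel_measurable)
  fix X n and A :: "(real ^ 'd) set"
  assume X: "stm_solution M F W b \<sigma> \<theta> \<tau> X" and A: "A \<in> sets borel"
  let ?F = "F (real n * \<tau>)" and ?B = "{\<omega> \<in> space M. X (Suc n) \<omega> \<in> A}"
  have F: "subalgebra M ?F" by (intro subalgebra_F grid)
  interpret finite_measure_subalgebra M ?F by unfold_locales (rule F)
  have XM: "X (Suc n) \<in> borel_measurable M"
    using solution_adapted[OF X] measurable_from_subalg subalgebra_F grid(1) by blast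
  have "AE \<omega> in M. nn_cond_exp M ?F (\<lambda>\<omega>. ennreal (indicat_real ?B \<omega>)) \<omega>
      = nn_cond_exp M ?F (\<lambda>\<omega>. indicator A (X (Suc n) \<omega>)) \<omega>"
    using XM A by (intro nn_cond_exp_cong) (auto simp: indicator_def)
  moreover have "AE \<omega> in M. nn_cond_exp M ?F (\<lambda>\<omega>. indicator A (X (Suc n) \<omega>)) \<omega>
      = (\<integral>\<^sup>+y. indicator A y \<partial>stm_kernel (X n \<omega>))"
    using nn_cond_exp_solution[OF X, of "indicator A"] A by simp
  \<comment> \<open>\<open>real_cond_exp\<close> subtracts the conditional expectation of the
    negative part, which is zero for an indicator.\<close>
  moreover have "AE \<omega> in M. 0 = nn_cond_exp M ?F (\<lambda>\<omega>. 0) \<omega>"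
    using nn_cond_exp_F_meas[of "\<lambda>_. 0"] by simp
  ultimately show "AE \<omega> in M. real_cond_exp M ?F (indicat_real ?B) \<omega> = measure (stm_kernel (X n \<omega>)) A"
  proof eventually_elim
    case (elim \<omega>)
    have "(\<lambda>\<omega>. ennreal (- indicat_real ?B \<omega>)) = (\<lambda>\<omega>. 0)"
      by (auto simp: fun_eq_iff indicator_def ennreal_neg)
    with elim A show ?case
      by (simp add: real_cond_exp_def kernel_space(2) measure_def)
  qed
qed

lemma solution_exists: "\<exists>X. stm_solution M F W b \<sigma> \<theta> \<tau> X \<and> X 0 = (\<lambda>_. x)"
proof -
  define X where "X = rec_nat (\<lambda>_. x) (\<lambda>j Y \<omega>. step (Y \<omega>) (\<Delta>W j \<omega>))"
  have "X 0 = (\<lambda>_. x)" "\<And>j. X (Suc j) = (\<lambda>\<omega>. step (X j \<omega>) (\<Delta>W j \<omega>))"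
    by (simp_all add: X_def)
  then show ?thesis by (intro exI[of _ X]) (simp add: stm_solution_iff)
qed

lemma transition_kernel_unique:
  assumes K: "stm_transition_kernel M F W b \<sigma> \<theta> \<tau> K"
  shows "K = stm_kernel"
  \<comment> \<open>Compare both kernels on the solution started deterministically at \<open>x\<close>.\<close>
proof
  fix x
  from solution_exists obtain X where X: "stm_solution M F W b \<sigma> \<theta> \<tau> X" "X 0 = (\<lambda>_. x)" by blast
  have Kx: "prob_space (K x)" "sets (K x) = sets borel"
    using K measurable_space[of K borel "prob_algebra borel" x]
    by (auto simp: stm_transition_kernel_def space_prob_algebra)
  show "K x = stm_kernel x"
  proof (rule measure_eqI)
    fix A assume "A \<in> sets (K x)"
    then have A: "A \<in> sets borel" by (simp add: Kx)
    have prob: "AE \<omega> in M. real_cond_exp M (F (real 0 * \<tau>)) (indicat_real {\<omega> \<in> space M. X (Suc 0) \<omega> \<in> A}) \<omega>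
        = measure (L x) A" if "stm_transition_kernel M F W b \<sigma> \<theta> \<tau> L" for L
      using conjunct2[OF that[unfolded stm_transition_kernel_def],
          THEN spec[of _ X], THEN mp, OF X(1), THEN spec[of _ 0], THEN bspec, OF A]
      unfolding X(2) .
    from prob[OF K] prob[OF kernel_transition]
    have "AE \<omega> in M. measure (K x) A = measure (stm_kernel x) A"
      by eventually_elim simp
    then have "measure (K x) A = measure (stm_kernel x) A" by simp
    then show "emeasure (K x) A = emeasure (stm_kernel x) A"
      using Kx kernel_space[of x]
      by (simp add: finite_measure.emeasure_eq_measure prob_space.finite_measure)
  qed (simp add: Kx kernel_space)
qed

end

subsection \<open>The Lyapunov drift estimate\<close>

locale dissipative_theta_method = theta_method b \<sigma> L1 \<theta> \<tau>
  for b :: "real ^ 'd \<Rightarrow> real ^ 'd" and \<sigma> :: "real ^ 'd \<Rightarrow> real ^ 'm ^ 'd" and L1 \<theta> \<tau> :: real +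
  fixes L2 L3 l :: real
  assumes L2_pos: "0 < L2" and L3_pos: "0 < L3"
    and dissipative: "2 * (b x \<bullet> x) + (norm (\<sigma> x))\<^sup>2 \<le> L2 - L3 * (norm x)\<^sup>2"
    and \<theta>_le_1: "\<theta> \<le> 1" and l_pos: "0 < l" and l_le: "l \<le> 2 * \<theta> - 1"
begin

abbreviation "V \<equiv> stm_lyapunov b \<sigma> \<theta> \<tau> l"

definition "\<rho> = (1 + (1 - \<theta>) * L3 * \<tau>) / (1 + (1 - \<theta> + l) * L3 * \<tau>)"

lemma norm_diff_drift: "(norm (x - (r * \<tau>) *\<^sub>R b x))\<^sup>2
    = (norm x)\<^sup>2 - 2 * r * (\<tau> * (b x \<bullet> x)) + r\<^sup>2 * (\<tau>\<^sup>2 * (norm (b x))\<^sup>2)"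
  unfolding power2_norm_eq_inner
  by (simp add: inner_diff inner_commute algebra_simps power2_eq_square)

lemma dissipative_scaled: "2 * (\<tau> * (b x \<bullet> x)) + \<tau> * (norm (\<sigma> x))\<^sup>2 \<le> L2 * \<tau> - L3 * \<tau> * (norm x)\<^sup>2"
  using mult_left_mono[OF dissipative[of x], of \<tau>] \<tau>_pos by (simp add: algebra_simps)

lemma square_nonneg: "0 \<le> (L3 * \<tau>)\<^sup>2 * (norm x)\<^sup>2 + 2 * (L3 * \<tau>) * (\<tau> * (b x \<bullet> x)) + \<tau>\<^sup>2 * (norm (b x))\<^sup>2"
proof -
  have "(norm ((L3 * \<tau>) *\<^sub>R x + \<tau> *\<^sub>R b x))\<^sup>2
      = (L3 * \<tau>)\<^sup>2 * (norm x)\<^sup>2 + 2 * (L3 * \<tau>) * (\<tau> * (b x \<bullet> x)) + \<tau>\<^sup>2 * (norm (b x))\<^sup>2"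
    unfolding power2_norm_eq_inner
    by (simp add: inner_add inner_commute algebra_simps power2_eq_square)
  then show ?thesis by (metis zero_le_power2)
qed

text \<open>The shape required by the polynomial inequalities: with a = 1 - \<theta> + l the weight
  2\<theta> - 1 - l is \<theta> - a.\<close>

lemma lyapunov_eq: "V x = ((norm x)\<^sup>2 - 2 * (1 - \<theta> + l) * (\<tau> * (b x \<bullet> x))
    + (1 - \<theta> + l)\<^sup>2 * (\<tau>\<^sup>2 * (norm (b x))\<^sup>2) + (\<theta> - (1 - \<theta> + l)) * (\<tau> * (norm (\<sigma> x))\<^sup>2)) + 1"
  unfolding stm_lyapunov_def norm_diff_drift by (simp add: algebra_simps)

lemma lyapunov_ge_1: "1 \<le> V x"
  using l_le \<tau>_pos by (simp add: stm_lyapunov_def)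

lemma lyapunov_measurable: "V \<in> borel_measurable borel"
  unfolding stm_lyapunov_def[abs_def]
  by (intro borel_measurable_continuous_onI continuous_intros b_cont \<sigma>_cont)

text \<open>Dissipativity bounds the inner product of \<open>b x\<close> and \<open>x\<close> from
  above, hence the cross term of \<open>V\<close> from below by a constant; the other terms are
  nonnegative, so \<open>V\<close> exceeds the squared norm of \<open>x\<close> up to a
  constant.\<close>

lemma lyapunov_coercive: "filterlim V at_top at_infinity"
proof (rule filterlim_at_top_mono)
  let ?a = "1 - \<theta> + l"
  have a: "0 \<le> ?a" using \<theta>_le_1 l_pos by simp
  show "filterlim (\<lambda>x::real ^ 'd. (- (?a * (L2 * \<tau>)) + 1) + (norm x)\<^sup>2) at_top at_infinity"
    by (intro filterlim_tendsto_add_at_top[OF tendsto_const] filterlim_pow_at_top filterlim_norm_at_top) simp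
  show "\<forall>\<^sub>F x in at_infinity. (- (?a * (L2 * \<tau>)) + 1) + (norm x)\<^sup>2 \<le> V x"
  proof (intro always_eventually allI)
    fix x
    have "?a * (2 * (\<tau> * (b x \<bullet> x))) \<le> ?a * (L2 * \<tau>)"
    proof (rule mult_left_mono[OF _ a])
      have "0 \<le> \<tau> * (norm (\<sigma> x))\<^sup>2" "0 \<le> L3 * \<tau> * (norm x)\<^sup>2" using \<tau>_pos L3_pos by simp_all
      then show "2 * (\<tau> * (b x \<bullet> x)) \<le> L2 * \<tau>" using dissipative_scaled[of x] by linarith
    qed
    moreover have "2 * ?a * (\<tau> * (b x \<bullet> x)) = ?a * (2 * (\<tau> * (b x \<bullet> x)))" by simp
    moreover have "0 \<le> ?a\<^sup>2 * (\<tau>\<^sup>2 * (norm (b x))\<^sup>2)" by simp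
    moreover have "0 \<le> (\<theta> - ?a) * (\<tau> * (norm (\<sigma> x))\<^sup>2)" using l_le \<tau>_pos by simp
    ultimately show "(- (?a * (L2 * \<tau>)) + 1) + (norm x)\<^sup>2 \<le> V x"
      unfolding lyapunov_eq by linarith
  qed
qed

lemma denominator_pos: "0 < 1 + (1 - \<theta> + l) * L3 * \<tau>"
  using \<theta>_le_1 l_pos L3_pos \<tau>_pos by (intro add_pos_nonneg mult_nonneg_nonneg) auto

lemma \<rho>_bounds: "0 < \<rho>" "\<rho> < 1"
proof -
  have "0 < 1 + (1 - \<theta>) * L3 * \<tau>"
    using \<theta>_le_1 L3_pos \<tau>_pos by (intro add_pos_nonneg mult_nonneg_nonneg) auto
  then show "0 < \<rho>" using denominator_pos by (simp add: \<rho>_def)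
  have "0 < l * L3 * \<tau>" using l_pos L3_pos \<tau>_pos by simp
  then show "\<rho> < 1" using denominator_pos by (simp add: \<rho>_def algebra_simps)
qed

text \<open>At most 1, since 1 - \<theta> + l \<le> \<theta>, with equality exactly for l =
  2\<theta> - 1.\<close>

definition "contraction = (1 + (1 - \<theta> + l) * (L3 * \<tau>)) / (1 + \<theta> * (L3 * \<tau>))"

definition "offset = (\<theta> - (1 - \<theta> + l)) * (L2 * \<tau>) + 1"

lemma contraction_nonneg: "0 \<le> contraction" and offset_nonneg: "0 \<le> offset"
proof -
  show "0 \<le> contraction" unfolding contraction_def
    using \<theta>_le_1 \<theta>_nonneg l_pos L3_pos \<tau>_pos
    by (intro divide_nonneg_nonneg add_nonneg_nonneg mult_nonneg_nonneg) auto
  show "0 \<le> offset" unfolding offset_def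
    using l_le L2_pos \<tau>_pos by (intro add_nonneg_nonneg mult_nonneg_nonneg) auto
qed

text \<open>Passes from \<open>V\<close> at the new state to \<open>implicit\<close> of that state,
  which is affine in the noise and so has a computable second moment.\<close>

lemma lyapunov_le_implicit: "V z \<le> contraction * (norm (implicit z))\<^sup>2 + offset"
proof -
  let ?a = "1 - \<theta> + l" and ?T = "1 + \<theta> * (L3 * \<tau>)"
  have T: "0 < ?T" using \<theta>_nonneg L3_pos \<tau>_pos by (intro add_pos_nonneg) auto
  have "?T * (V z - 1) \<le> (1 + ?a * (L3 * \<tau>)) * (norm (implicit z))\<^sup>2 + ?T * ((\<theta> - ?a) * (L2 * \<tau>))"
    unfolding lyapunov_eq implicit_def norm_diff_drift add_diff_cancel_right'
    using dissipative_scaled square_nonneg \<theta>_le_1 l_pos l_le L3_pos \<tau>_pos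
    by (intro theta_resolvent_inequality) auto
  then show ?thesis using T by (simp add: contraction_def offset_def field_simps)
qed

lemma explicit_le_lyapunov:
  "contraction * ((norm (explicit x))\<^sup>2 + \<tau> * (norm (\<sigma> x))\<^sup>2) + offset \<le> \<rho> * V x + (L2 * \<tau> + (1 - \<rho>))"
proof -
  let ?a = "1 - \<theta> + l" and ?c = "1 - \<theta>" and ?h = "L3 * \<tau>"
  let ?T = "1 + \<theta> * ?h" and ?N = "1 + ?c * ?h" and ?D = "1 + ?a * ?h"
  let ?E = "(norm (explicit x))\<^sup>2 + \<tau> * (norm (\<sigma> x))\<^sup>2"
  have T: "0 < ?T" using \<theta>_nonneg L3_pos \<tau>_pos by (intro add_pos_nonneg) auto
  have D: "0 < ?D" using denominator_pos by (simp add: mult_ac)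
  have expl: "(norm (explicit x))\<^sup>2
      = (norm x)\<^sup>2 + 2 * ?c * (\<tau> * (b x \<bullet> x)) + ?c\<^sup>2 * (\<tau>\<^sup>2 * (norm (b x))\<^sup>2)"
    using norm_diff_drift[of x "- ?c"] by (simp add: explicit_def algebra_simps power2_eq_square)
  have "?D\<^sup>2 * ?E \<le> ?T * (?N * (V x - 1) + ?D * (?a + ?c) * (L2 * \<tau>))"
    unfolding lyapunov_eq expl add_diff_cancel_right'
    using dissipative_scaled square_nonneg \<theta>_le_1 l_pos l_le L2_pos L3_pos \<tau>_pos
    by (intro theta_drift_inequality) auto
  then have "?D * (?D * ?E) \<le> (?N * (V x - 1) + ?D * (?a + ?c) * (L2 * \<tau>)) * ?T"
    by (simp only: power2_eq_square mult_ac)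
  then have "?D * (?D * ?E / ?T) \<le> ?N * (V x - 1) + ?D * (?a + ?c) * (L2 * \<tau>)"
    using T by (simp only: times_divide_eq_right pos_divide_le_eq)
  also have "\<dots> = ?D * (?N / ?D * (V x - 1) + (?a + ?c) * (L2 * \<tau>))"
    using D by (simp add: distrib_left)
  finally have "?D * ?E / ?T \<le> ?N / ?D * (V x - 1) + (?a + ?c) * (L2 * \<tau>)"
    using D by (simp only: mult_le_cancel_left_pos)
  moreover have "contraction * ?E = ?D * ?E / ?T" "\<rho> = ?N / ?D"
    by (simp_all add: contraction_def \<rho>_def mult_ac)
  ultimately have "contraction * ?E \<le> \<rho> * (V x - 1) + (?a + ?c) * (L2 * \<tau>)" by simp
  \<comment> \<open>The constants recombine: (a + c) + (\<theta> - a) = 1 leaves exactly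
    \<open>L2 * \<tau>\<close>, and the 1 in \<open>offset\<close> together with the -\<rho> from
    \<open>\<rho> * (V x - 1)\<close> gives 1 - \<rho>.\<close>
  then show ?thesis by (simp add: offset_def algebra_simps)
qed

end

section \<open>The drift estimate for the kernel and for conditional expectations\<close>

locale dissipative_theta_scheme = theta_scheme M F W b \<sigma> L1 \<theta> \<tau>
    + dissipative_theta_method b \<sigma> L1 \<theta> \<tau> L2 L3 l
  for M :: "'w measure" and F :: "real \<Rightarrow> 'w measure" and W :: "real \<Rightarrow> 'w \<Rightarrow> real ^ 'm"
    and b :: "real ^ 'd \<Rightarrow> real ^ 'd" and \<sigma> :: "real ^ 'd \<Rightarrow> real ^ 'm ^ 'd"
    and L1 \<theta> \<tau> L2 L3 l :: real
begin

text \<open>Bound \<open>V\<close> through \<open>implicit\<close>, integrate the resulting square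
  exactly using increment variance \<tau>, and finish with the pointwise bound
  \<open>explicit_le_lyapunov\<close>.\<close>

lemma nn_integral_lyapunov_kernel:
  "(\<integral>\<^sup>+y. ennreal (V y) \<partial>stm_kernel x) \<le> ennreal (\<rho> * V x + (L2 * \<tau> + (1 - \<rho>)))"
proof -
  let ?g = "\<lambda>w. contraction * (norm (explicit x + \<sigma> x *v w))\<^sup>2 + offset"
  have "has_bochner_integral M (\<lambda>\<omega>. (norm (explicit x + \<sigma> x *v \<Delta>W 0 \<omega>))\<^sup>2)
      ((norm (explicit x))\<^sup>2 + \<tau> * (norm (\<sigma> x))\<^sup>2)"
    using increment_component_moments[OF grid[of 0]]
    by (intro has_bochner_integral_norm_affine_square increment_indep_components[OF grid]) auto
  then have g: "has_bochner_integral M (\<lambda>\<omega>. ?g (\<Delta>W 0 \<omega>))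
      (contraction * ((norm (explicit x))\<^sup>2 + \<tau> * (norm (\<sigma> x))\<^sup>2) + offset)"
    by (intro has_bochner_integral_add has_bochner_integral_mult_right)
       (auto simp: has_bochner_integral_iff prob_space)
  have "(\<integral>\<^sup>+y. ennreal (V y) \<partial>stm_kernel x) = (\<integral>\<^sup>+w. ennreal (V (step x w)) \<partial>noise)"
    using lyapunov_measurable by (intro nn_integral_kernel) simp
  also have "\<dots> = (\<integral>\<^sup>+\<omega>. ennreal (V (step x (\<Delta>W 0 \<omega>))) \<partial>M)"
    unfolding noise_def
    using measurable_compose[OF step_measurable2 lyapunov_measurable, of x]
    by (intro nn_integral_distr increment_measurable) simp
  also have "\<dots> \<le> (\<integral>\<^sup>+\<omega>. ennreal (?g (\<Delta>W 0 \<omega>)) \<partial>M)"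
    using lyapunov_le_implicit[of "step x _"]
    by (intro nn_integral_mono ennreal_leI) (simp only: implicit_step)
  also have "\<dots> = ennreal (contraction * ((norm (explicit x))\<^sup>2 + \<tau> * (norm (\<sigma> x))\<^sup>2) + offset)"
    using g contraction_nonneg offset_nonneg
    by (subst nn_integral_eq_integral) (auto simp: has_bochner_integral_iff)
  also have "\<dots> \<le> ennreal (\<rho> * V x + (L2 * \<tau> + (1 - \<rho>)))"
    by (intro ennreal_leI explicit_le_lyapunov)
  finally show ?thesis .
qed

text \<open>Integrability gives the second claim its content, because the Bochner integral of a
  nonintegrable function is 0 by convention.\<close>

lemma integrable_lyapunov_kernel: "integrable (stm_kernel x) V"
  and transition_op_lyapunov: "transition_op stm_kernel V x \<le> \<rho> * V x + (L2 * \<tau> + (1 - \<rho>))"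
proof -
  have V0: "0 \<le> V y" for y using lyapunov_ge_1[of y] by simp
  have meas: "V \<in> borel_measurable (stm_kernel x)"
    using lyapunov_measurable by (simp add: measurable_cong_sets[OF kernel_space(2)])
  show int: "integrable (stm_kernel x) V"
    using nn_integral_lyapunov_kernel[of x] meas V0
    by (intro integrableI_nonneg) (auto intro: le_less_trans)
  \<comment> \<open>\<open>ennreal\<close> sends negative reals to 0, so the bound returns to the
    reals only once its right side is known to be nonnegative.\<close>
  have "0 \<le> \<rho> * V x + (L2 * \<tau> + (1 - \<rho>))"
    using \<rho>_bounds V0 L2_pos \<tau>_pos by (intro add_nonneg_nonneg mult_nonneg_nonneg) auto
  moreover have "ennreal (transition_op stm_kernel V x) \<le> ennreal (\<rho> * V x + (L2 * \<tau> + (1 - \<rho>)))"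
    using nn_integral_lyapunov_kernel[of x] int V0
    unfolding transition_op_def by (subst (asm) nn_integral_eq_integral) auto
  ultimately show "transition_op stm_kernel V x \<le> \<rho> * V x + (L2 * \<tau> + (1 - \<rho>))"
    by (simp add: ennreal_le_iff)
qed

text \<open>The extended nonnegative conditional expectation covers every initial state, even when
  \<open>V (X 0 \<omega>)\<close> is not integrable in \<omega>.\<close>

lemma nn_cond_exp_lyapunov:
  assumes "stm_solution M F W b \<sigma> \<theta> \<tau> X"
  shows "AE \<omega> in M. nn_cond_exp M (F (real n * \<tau>)) (\<lambda>\<omega>. ennreal (V (X (Suc n) \<omega>))) \<omega>
    \<le> ennreal (\<rho> * V (X n \<omega>) + (L2 * \<tau> + (1 - \<rho>)))"
proof -
  have "(\<lambda>y. ennreal (V y)) \<in> borel_measurable borel" using lyapunov_measurable by simp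
  from nn_cond_exp_solution[OF assms this, of n] show ?thesis
    by eventually_elim (simp add: nn_integral_lyapunov_kernel)
qed

end

theorem theorem1:
  fixes M :: "'w measure" and F :: "real \<Rightarrow> 'w measure" and W :: "real \<Rightarrow> 'w \<Rightarrow> real ^ 'm"
    and b :: "real ^ 'd \<Rightarrow> real ^ 'd" and \<sigma> :: "real ^ 'd \<Rightarrow> real ^ 'm ^ 'd"
    and L1 L2 L3 \<theta> \<tau> l \<rho> \<kappa> :: real
  assumes W: "wiener_process M F W"
    and b_cont: "continuous_on UNIV b"
    and \<sigma>_cont: "continuous_on UNIV \<sigma>"
    and L2_pos: "L2 > 0" and L3_pos: "L3 > 0"
    and one_sided: "\<And>x y. 2 * ((b x - b y) \<bullet> (x - y)) + (norm (\<sigma> x - \<sigma> y))\<^sup>2 \<le> L1 * (norm (x - y))\<^sup>2"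
    and dissipative: "\<And>x. 2 * (b x \<bullet> x) + (norm (\<sigma> x))\<^sup>2 \<le> L2 - L3 * (norm x)\<^sup>2"
    and \<theta>: "1 / 2 < \<theta>" "\<theta> \<le> 1"
    and \<tau>: "0 < \<tau>" "\<tau> < 1" "L1 * \<theta> * \<tau> < 2"
    and l: "0 < l" "l \<le> 2 * \<theta> - 1"
    and \<rho>_eq: "\<rho> = (1 + (1 - \<theta>) * L3 * \<tau>) / (1 + (1 - \<theta> + l) * L3 * \<tau>)"
    and \<kappa>_eq: "\<kappa> = L2 * \<tau> + (1 - \<rho>)"
  shows "(\<forall>x. 1 \<le> stm_lyapunov b \<sigma> \<theta> \<tau> l x) \<and>
    filterlim (stm_lyapunov b \<sigma> \<theta> \<tau> l) at_top at_infinity \<and>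
    0 < \<rho> \<and> \<rho> < 1 \<and> 0 < \<kappa> \<and>
    (\<exists>!K. stm_transition_kernel M F W b \<sigma> \<theta> \<tau> K) \<and>
    (\<forall>K. stm_transition_kernel M F W b \<sigma> \<theta> \<tau> K \<longrightarrow>
      (\<forall>x. integrable (K x) (stm_lyapunov b \<sigma> \<theta> \<tau> l) \<and>
        transition_op K (stm_lyapunov b \<sigma> \<theta> \<tau> l) x \<le> \<rho> * stm_lyapunov b \<sigma> \<theta> \<tau> l x + \<kappa>)) \<and>
    (\<forall>X. stm_solution M F W b \<sigma> \<theta> \<tau> X \<longrightarrow>
      (\<forall>n. AE \<omega> in M.
        nn_cond_exp M (F (real n * \<tau>)) (\<lambda>\<omega>. ennreal (stm_lyapunov b \<sigma> \<theta> \<tau> l (X (Suc n) \<omega>))) \<omega>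
          \<le> ennreal ((1 + (1 - \<theta>) * L3 * \<tau>) / (1 + (1 - \<theta> + l) * L3 * \<tau>)
                * stm_lyapunov b \<sigma> \<theta> \<tau> l (X n \<omega>)
              + L2 * \<tau> + l * L3 * \<tau> / (1 + (1 - \<theta> + l) * L3 * \<tau>))))"
proof -
  interpret W: wiener_process M F W by (rule W)
  interpret S: dissipative_theta_scheme M F W b \<sigma> L1 \<theta> \<tau> L2 L3 l
    by unfold_locales (use assms in \<open>auto simp: mult_ac\<close>)
  have \<rho>: "S.\<rho> = \<rho>" unfolding S.\<rho>_def \<rho>_eq ..
  have "1 - \<rho> = l * L3 * \<tau> / (1 + (1 - \<theta> + l) * L3 * \<tau>)"
    using S.denominator_pos by (simp add: \<rho>_eq field_simps)
  then have drift: "(1 + (1 - \<theta>) * L3 * \<tau>) / (1 + (1 - \<theta> + l) * L3 * \<tau>) * v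
      + L2 * \<tau> + l * L3 * \<tau> / (1 + (1 - \<theta> + l) * L3 * \<tau>) = \<rho> * v + (L2 * \<tau> + (1 - \<rho>))" for v
    unfolding \<rho>_eq by simp
  have "0 < L2 * \<tau>" using L2_pos \<tau>(1) by simp
  then have \<kappa>: "0 < \<kappa>" using S.\<rho>_bounds unfolding \<kappa>_eq \<rho> by simp
  have kernel: "\<exists>!K. stm_transition_kernel M F W b \<sigma> \<theta> \<tau> K"
    using S.kernel_transition S.transition_kernel_unique by blast
  show ?thesis
    unfolding drift
  proof (intro conjI allI impI)
    fix K x assume "stm_transition_kernel M F W b \<sigma> \<theta> \<tau> K"
    then have K: "K = S.stm_kernel" by (rule S.transition_kernel_unique)
    show "integrable (K x) S.V" unfolding K by (rule S.integrable_lyapunov_kernel)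
    show "transition_op K S.V x \<le> \<rho> * S.V x + \<kappa>"
      unfolding K \<kappa>_eq by (rule S.transition_op_lyapunov[unfolded \<rho>])
  next
    fix X n assume "stm_solution M F W b \<sigma> \<theta> \<tau> X"
    from S.nn_cond_exp_lyapunov[OF this, of n]
    show "AE \<omega> in M. nn_cond_exp M (F (real n * \<tau>)) (\<lambda>\<omega>. ennreal (S.V (X (Suc n) \<omega>))) \<omega>
        \<le> ennreal (\<rho> * S.V (X n \<omega>) + (L2 * \<tau> + (1 - \<rho>)))"
      unfolding \<rho> .
  qed (use S.lyapunov_ge_1 S.lyapunov_coercive S.\<rho>_bounds \<rho> \<kappa> kernel in auto)
qed

end
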